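(* Let $M$ be an object of PreCu. If there is a completion of $M$, then it is unique up to order-isomorphism.
   Context: All monoids are commutative, written additively with neutral element $0$, and equipped with a partial order $\le$ compatible with addition such that $x\ge 0$ for every element $x$. Maps between monoids are additive, order-preserving and preserve $0$. A monoid map $\varphi\colon M\to N$ is an order-embedding if $a\le b$ whenever $\varphi(a)\le\varphi(b)$. The supremum of an increasing sequence is its least upper bound, if it exists. For $x,y$ in a monoid $M$, write $x\ll y$ if, whenever $(y_n)$ is an increasing sequence in $M$ whose supremum exists in $M$ and $y\le\sup y_n$, then $x\le y_k$ for some $k$. A sequence $(x_n)$ is rapidly increasing if $x_n\ll x_{n+1}$ for all $n$. PreCu is the category whose objects are the monoids $M$ (commutative, written additively with neutral element $0$, and equipped with a partial order $\le$ compatible with addition such that $x\ge 0$ for every $x\in M$) such that (i) every element of $M$ is the supremum of a rapidly increasing sequence in $M$; (ii) $\ll$ and suprema are compatible with addition: $x\ll y$ and $z\ll t$ imply $x+z\ll y+t$, and if $(x_n)$, $(y_n)$ are increasing sequences with suprema $x$, $y$, then $x+y$ is the supremum of $(x_n+y_n)$. Maps in PreCu are monoid maps that preserve suprema of increasing sequences (when they exist) and preserve $\ll$. Cu is the full subcategory of PreCu consisting of the objects in which every increasing sequence has a supremum. A completion of an object $M$ of PreCu is a pair $(N,\iota)$ such that (i) $N$ is an object of Cu; (ii) $\iota\colon M\to N$ is an order-embedding and a map in PreCu; (iii) for every $x\in N$ there is a rapidly increasing sequence $(x_n)$ in $M$ such that $x=\sup\iota(x_n)$. *)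

theory Defs
  imports Main
begin

class pos_ordered_comm_monoid = ordered_comm_monoid_add +
  assumes zero_least: "0 \<le> x"

context order
begin

text \<open>\<open>monotone (\<le>) (\<le>) u\<close> is what \<open>mono u\<close> stands for outside the class context.\<close>

definition is_sup :: "(nat \<Rightarrow> 'a) \<Rightarrow> 'a \<Rightarrow> bool"
  where "is_sup u s \<longleftrightarrow> (\<forall>n. u n \<le> s) \<and> (\<forall>b. (\<forall>n. u n \<le> b) \<longrightarrow> s \<le> b)"

definition way_below :: "'a \<Rightarrow> 'a \<Rightarrow> bool"  (infix \<open>\<lless>\<close> 50)
  where "x \<lless> y \<longleftrightarrow>
    (\<forall>u s. monotone (\<le>) (\<le>) u \<longrightarrow> is_sup u s \<longrightarrow> y \<le> s \<longrightarrow> (\<exists>k. x \<le> u k))"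

definition rapidly_increasing :: "(nat \<Rightarrow> 'a) \<Rightarrow> bool"
  where "rapidly_increasing u \<longleftrightarrow> (\<forall>n. u n \<lless> u (Suc n))"

end

class precu = pos_ordered_comm_monoid +
  assumes ex_rapidly_increasing: "\<exists>u. rapidly_increasing u \<and> is_sup u x"
    and way_below_add: "x \<lless> y \<Longrightarrow> z \<lless> t \<Longrightarrow> x + z \<lless> y + t"
    and is_sup_add: "monotone (\<le>) (\<le>) u \<Longrightarrow> monotone (\<le>) (\<le>) v \<Longrightarrow> is_sup u x \<Longrightarrow> is_sup v y \<Longrightarrow>
      is_sup (\<lambda>n. u n + v n) (x + y)"

class cu = precu +
  assumes ex_is_sup: "monotone (\<le>) (\<le>) u \<Longrightarrow> \<exists>x. is_sup u x"

definition monoid_map :: "('a::pos_ordered_comm_monoid \<Rightarrow> 'b::pos_ordered_comm_monoid) \<Rightarrow> bool"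
  where "monoid_map f \<longleftrightarrow> f 0 = 0 \<and> (\<forall>x y. f (x + y) = f x + f y) \<and> mono f"

definition order_embedding :: "('a::pos_ordered_comm_monoid \<Rightarrow> 'b::pos_ordered_comm_monoid) \<Rightarrow> bool"
  where "order_embedding f \<longleftrightarrow> monoid_map f \<and> (\<forall>x y. f x \<le> f y \<longrightarrow> x \<le> y)"

definition order_isomorphism :: "('a::pos_ordered_comm_monoid \<Rightarrow> 'b::pos_ordered_comm_monoid) \<Rightarrow> bool"
  where "order_isomorphism f \<longleftrightarrow> order_embedding f \<and> bij f"

definition precu_map :: "('a::precu \<Rightarrow> 'b::precu) \<Rightarrow> bool"
  where "precu_map f \<longleftrightarrow> monoid_map f \<and>
    (\<forall>u s. mono u \<longrightarrow> is_sup u s \<longrightarrow> is_sup (\<lambda>n. f (u n)) (f s)) \<and>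
    (\<forall>x y. x \<lless> y \<longrightarrow> f x \<lless> f y)"

text \<open>A completion of \<open>'m\<close> is the pair consisting of the type \<open>'n\<close> and the map \<open>\<iota>\<close>; that
  \<open>'n\<close> is an object of Cu is expressed by its sort.\<close>

definition is_completion :: "('m::precu \<Rightarrow> 'n::cu) \<Rightarrow> bool"
  where "is_completion \<iota> \<longleftrightarrow> order_embedding \<iota> \<and> precu_map \<iota> \<and>
    (\<forall>x. \<exists>u. rapidly_increasing u \<and> is_sup (\<lambda>n. \<iota> (u n)) x)"

end

theory Submission
  imports Defs
begin

text \<open>If \<open>u\<close> and \<open>v\<close> are rapidly increasing in \<open>M\<close>, then in every completion
  \<open>sup \<iota>(u\<^sub>n) \<le> sup \<iota>(v\<^sub>n)\<close> holds exactly when every \<open>u\<^sub>n\<close> lies below some \<open>v\<^sub>m\<close>,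
  a condition that involves \<open>M\<close> alone. Hence sending \<open>sup \<iota>\<^sub>1(u\<^sub>n)\<close> to \<open>sup \<iota>\<^sub>2(u\<^sub>n)\<close> is a
  well-defined order-isomorphism between two completions.\<close>

lemma is_sup_const: "is_sup (\<lambda>n. x :: 'a::order) x"
  by (simp add: is_sup_def)

text \<open>Test the definition of \<open>\<lless>\<close> on the constant sequence at
  \<open>y\<close>, whose supremum is \<open>y\<close>.\<close>

lemma way_below_imp_le:
  fixes x y :: "'a::order"
  assumes "x \<lless> y"
  shows "x \<le> y"
  using assms is_sup_const[of y] by (force simp: way_below_def monotone_def)

lemma rapidly_increasing_imp_mono:
  fixes u :: "nat \<Rightarrow> 'a::order"
  assumes "rapidly_increasing u"
  shows "mono u"
  using assms by (auto simp: rapidly_increasing_def mono_iff_le_Suc intro: way_below_imp_le)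

lemma rapidly_increasing_add:
  fixes u v :: "nat \<Rightarrow> 'a::precu"
  assumes "rapidly_increasing u" and "rapidly_increasing v"
  shows "rapidly_increasing (\<lambda>n. u n + v n)"
  using assms by (simp add: rapidly_increasing_def way_below_add)

lemma is_completion_mono_comp:
  assumes "is_completion \<iota>" and "rapidly_increasing u"
  shows "mono (\<lambda>n. \<iota> (u n))"
proof -
  have "mono \<iota>"
    using assms(1) by (simp add: is_completion_def order_embedding_def monoid_map_def)
  then show ?thesis
    using rapidly_increasing_imp_mono[OF assms(2)] by (simp add: mono_def)
qed

text \<open>The right-hand side lives in the domain of \<open>\<iota>\<close> alone, which makes
  different completions comparable. Forward, \<open>\<iota>\<close> preserves
  \<open>\<lless>\<close> and reflects \<open>\<le>\<close>; backward, \<open>\<iota>\<close> is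
  monotone.\<close>

lemma is_completion_sup_le_iff:
  assumes \<iota>: "is_completion \<iota>"
    and u: "rapidly_increasing u" "is_sup (\<lambda>n. \<iota> (u n)) x"
    and v: "rapidly_increasing v" "is_sup (\<lambda>n. \<iota> (v n)) y"
  shows "x \<le> y \<longleftrightarrow> (\<forall>n. \<exists>m. u n \<le> v m)"
proof
  assume "x \<le> y"
  show "\<forall>n. \<exists>m. u n \<le> v m"
  proof
    fix n
    \<comment> \<open>Moving one index up gains the strictness: the next term is still below
      \<open>y\<close>, the supremum of the \<open>\<iota> (v m)\<close>, so
      \<open>\<iota> (u n)\<close> must lie below one of these.\<close>
    have "\<iota> (u n) \<lless> \<iota> (u (Suc n))"
      using \<iota> u(1) by (simp add: is_completion_def precu_map_def rapidly_increasing_def)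
    moreover have "\<iota> (u (Suc n)) \<le> y"
      using u(2) \<open>x \<le> y\<close> by (meson is_sup_def order_trans)
    ultimately obtain m where "\<iota> (u n) \<le> \<iota> (v m)"
      using is_completion_mono_comp[OF \<iota> v(1)] v(2) unfolding way_below_def by blast
    then show "\<exists>m. u n \<le> v m"
      using \<iota> by (auto simp: is_completion_def order_embedding_def)
  qed
next
  assume *: "\<forall>n. \<exists>m. u n \<le> v m"
  have "mono \<iota>"
    using \<iota> by (simp add: is_completion_def order_embedding_def monoid_map_def)
  have "\<iota> (u n) \<le> y" for n
  proof -
    obtain m where "u n \<le> v m"
      using * by blast
    then have "\<iota> (u n) \<le> \<iota> (v m)"
      using \<open>mono \<iota>\<close> by (rule monoD[rotated])
    also have "\<dots> \<le> y"
      using v(2) by (simp add: is_sup_def)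
    finally show ?thesis .
  qed
  then show "x \<le> y"
    using u(2) by (simp add: is_sup_def)
qed

text \<open>The graph of the future isomorphism, kept as a relation because many sequences
  \<open>u\<close> may approximate the same \<open>x\<close>. It is symmetric in the two
  completions, so facts about it also serve with the roles exchanged.\<close>

definition common_sup :: "('m::precu \<Rightarrow> 'a::cu) \<Rightarrow> ('m \<Rightarrow> 'b::cu) \<Rightarrow> 'a \<Rightarrow> 'b \<Rightarrow> bool"
  where "common_sup \<iota>\<^sub>1 \<iota>\<^sub>2 x y \<longleftrightarrow>
    (\<exists>u. rapidly_increasing u \<and> is_sup (\<lambda>n. \<iota>\<^sub>1 (u n)) x \<and> is_sup (\<lambda>n. \<iota>\<^sub>2 (u n)) y)"

lemma common_sup_commute: "common_sup \<iota>\<^sub>1 \<iota>\<^sub>2 x y \<longleftrightarrow> common_sup \<iota>\<^sub>2 \<iota>\<^sub>1 y x"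
  by (auto simp: common_sup_def)

text \<open>The first completion supplies a sequence for \<open>x\<close>; its image under
  \<open>\<iota>\<^sub>2\<close> is increasing and so has a supremum in an object of Cu.\<close>

lemma ex_common_sup:
  assumes "is_completion \<iota>\<^sub>1" and "is_completion \<iota>\<^sub>2"
  shows "\<exists>y. common_sup \<iota>\<^sub>1 \<iota>\<^sub>2 x y"
proof -
  obtain u where u: "rapidly_increasing u" "is_sup (\<lambda>n. \<iota>\<^sub>1 (u n)) x"
    using assms(1) by (auto simp: is_completion_def)
  obtain y where "is_sup (\<lambda>n. \<iota>\<^sub>2 (u n)) y"
    using ex_is_sup[OF is_completion_mono_comp[OF assms(2) u(1)]] by blast
  with u show ?thesis
    by (auto simp: common_sup_def)
qed

text \<open>Both inequalities are equivalent to the same condition on the two witnessing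
  sequences.\<close>

lemma common_sup_le_iff:
  assumes "is_completion \<iota>\<^sub>1" and "is_completion \<iota>\<^sub>2"
    and "common_sup \<iota>\<^sub>1 \<iota>\<^sub>2 x y" and "common_sup \<iota>\<^sub>1 \<iota>\<^sub>2 x' y'"
  shows "x \<le> x' \<longleftrightarrow> y \<le> y'"
proof -
  obtain u where u: "rapidly_increasing u" "is_sup (\<lambda>n. \<iota>\<^sub>1 (u n)) x" "is_sup (\<lambda>n. \<iota>\<^sub>2 (u n)) y"
    using assms(3) by (auto simp: common_sup_def)
  obtain v where v: "rapidly_increasing v" "is_sup (\<lambda>n. \<iota>\<^sub>1 (v n)) x'" "is_sup (\<lambda>n. \<iota>\<^sub>2 (v n)) y'"
    using assms(4) by (auto simp: common_sup_def)
  show ?thesis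
    using is_completion_sup_le_iff[OF assms(1) u(1,2) v(1,2)]
      is_completion_sup_le_iff[OF assms(2) u(1,3) v(1,3)] by simp
qed

text \<open>By antisymmetry the relation is single-valued in both directions, which makes the map
  well-defined.\<close>

lemma common_sup_eq_iff:
  assumes "is_completion \<iota>\<^sub>1" and "is_completion \<iota>\<^sub>2"
    and "common_sup \<iota>\<^sub>1 \<iota>\<^sub>2 x y" and "common_sup \<iota>\<^sub>1 \<iota>\<^sub>2 x' y'"
  shows "x = x' \<longleftrightarrow> y = y'"
  using common_sup_le_iff[OF assms] common_sup_le_iff[OF assms(1,2,4,3)]
  by (simp add: order_eq_iff)

lemma is_completion_sup_add:
  assumes \<iota>: "is_completion \<iota>"
    and u: "rapidly_increasing u" "is_sup (\<lambda>n. \<iota> (u n)) x"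
    and v: "rapidly_increasing v" "is_sup (\<lambda>n. \<iota> (v n)) y"
  shows "is_sup (\<lambda>n. \<iota> (u n + v n)) (x + y)"
proof -
  have "\<iota> (a + b) = \<iota> a + \<iota> b" for a b
    using \<iota> by (simp add: is_completion_def order_embedding_def monoid_map_def)
  then show ?thesis
    using is_sup_add[OF is_completion_mono_comp[OF \<iota> u(1)] is_completion_mono_comp[OF \<iota> v(1)] u(2) v(2)]
    by simp
qed

text \<open>The termwise sum of the two witnessing sequences is a witness, as
  \<open>\<lless>\<close> and suprema are compatible with addition.\<close>

lemma common_sup_add:
  assumes "is_completion \<iota>\<^sub>1" and "is_completion \<iota>\<^sub>2"
    and "common_sup \<iota>\<^sub>1 \<iota>\<^sub>2 x y" and "common_sup \<iota>\<^sub>1 \<iota>\<^sub>2 x' y'"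
  shows "common_sup \<iota>\<^sub>1 \<iota>\<^sub>2 (x + x') (y + y')"
proof -
  obtain u where u: "rapidly_increasing u" "is_sup (\<lambda>n. \<iota>\<^sub>1 (u n)) x" "is_sup (\<lambda>n. \<iota>\<^sub>2 (u n)) y"
    using assms(3) by (auto simp: common_sup_def)
  obtain v where v: "rapidly_increasing v" "is_sup (\<lambda>n. \<iota>\<^sub>1 (v n)) x'" "is_sup (\<lambda>n. \<iota>\<^sub>2 (v n)) y'"
    using assms(4) by (auto simp: common_sup_def)
  show ?thesis
    unfolding common_sup_def
    using rapidly_increasing_add[OF u(1) v(1)]
      is_completion_sup_add[OF assms(1) u(1,2) v(1,2)]
      is_completion_sup_add[OF assms(2) u(1,3) v(1,3)] by blast
qed

text \<open>Any rapidly increasing sequence with supremum \<open>a\<close> is a witness, since both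
  maps preserve existing suprema.\<close>

lemma common_sup_image:
  assumes "is_completion \<iota>\<^sub>1" and "is_completion \<iota>\<^sub>2"
  shows "common_sup \<iota>\<^sub>1 \<iota>\<^sub>2 (\<iota>\<^sub>1 a) (\<iota>\<^sub>2 a)"
proof -
  obtain u where "rapidly_increasing u" "is_sup u a"
    using ex_rapidly_increasing by blast
  with rapidly_increasing_imp_mono[of u] assms show ?thesis
    unfolding common_sup_def is_completion_def precu_map_def by blast
qed

theorem corollary3p4:
  fixes \<iota>\<^sub>1 :: "'m::precu \<Rightarrow> 'n\<^sub>1::cu"
    and \<iota>\<^sub>2 :: "'m \<Rightarrow> 'n\<^sub>2::cu"
  assumes "is_completion \<iota>\<^sub>1"
    and "is_completion \<iota>\<^sub>2"
  shows "\<exists>\<phi> :: 'n\<^sub>1 \<Rightarrow> 'n\<^sub>2. order_isomorphism \<phi> \<and> (\<forall>x. \<phi> (\<iota>\<^sub>1 x) = \<iota>\<^sub>2 x)"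
proof -
  obtain \<phi> where \<phi>: "common_sup \<iota>\<^sub>1 \<iota>\<^sub>2 x (\<phi> x)" for x
    using ex_common_sup[OF assms] by metis
  have \<phi>_eqI: "\<phi> x = y" if "common_sup \<iota>\<^sub>1 \<iota>\<^sub>2 x y" for x y
    using common_sup_eq_iff[OF assms \<phi> that] by blast
  have le_iff: "\<phi> x \<le> \<phi> x' \<longleftrightarrow> x \<le> x'" for x x'
    using common_sup_le_iff[OF assms \<phi> \<phi>] by simp
  have \<phi>_\<iota>: "\<phi> (\<iota>\<^sub>1 a) = \<iota>\<^sub>2 a" for a
    by (rule \<phi>_eqI[OF common_sup_image[OF assms]])
  have "\<iota>\<^sub>1 0 = 0" "\<iota>\<^sub>2 0 = 0"
    using assms by (simp_all add: is_completion_def order_embedding_def monoid_map_def)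
  with \<phi>_\<iota>[of 0] have "\<phi> 0 = 0"
    by simp
  moreover have "\<phi> (x + x') = \<phi> x + \<phi> x'" for x x'
    by (rule \<phi>_eqI[OF common_sup_add[OF assms \<phi> \<phi>]])
  moreover have "bij \<phi>"
  proof (rule bijI)
    show "inj \<phi>"
      by (rule injI) (simp add: order_eq_iff le_iff)
    show "surj \<phi>"
    proof (rule surjI)
      fix y
      \<comment> \<open>A preimage of \<open>y\<close> is any element related to it; one exists by
        totality with the two completions exchanged.\<close>
      show "\<phi> (SOME x. common_sup \<iota>\<^sub>1 \<iota>\<^sub>2 x y) = y"
        using ex_common_sup[OF assms(2,1), of y] common_sup_commute
        by (metis \<phi>_eqI someI_ex)
    qed
  qed
  ultimately have "order_isomorphism \<phi>"
    by (simp add: order_isomorphism_def order_embedding_def monoid_map_def mono_def le_iff)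
  with \<phi>_\<iota> show ?thesis
    by blast
qed

end
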